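(* Let $A\subseteq\mathbb{N}$ be arbitrary, and let $B\subseteq\mathbb{N}$ be such that neither $B$ nor $\mathbb{N}\setminus B$ is negligible. Then there exists a uniform total function $f\colon\mathbb{N}\to\mathbb{N}$ that reduces $A$ to $B$, i.e., $f(A)\subseteq B$ and $f(\mathbb{N}\setminus A)\subseteq \mathbb{N}\setminus B$.
   Context: For $A\subseteq \mathbb{N}$ and $n\ge 1$, $\rho_n(A) = \#\{k<n \mid k\in A\}/n$. A set $A$ is negligible if $\lim_n \rho_n(A)=0$. A total function $f\colon\mathbb{N}\to\mathbb{N}$ is uniform if $f^{-1}(S)$ is negligible for every negligible $S\subseteq\mathbb{N}$. No computability is assumed. *)

theory Defs
  imports Complex_Main
begin

(* For n = 0 division by zero gives the value 0; this has no effect on limits. *)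
definition rho :: "nat \<Rightarrow> nat set \<Rightarrow> real" where
  "rho n A = real (card {k. k < n \<and> k \<in> A}) / real n"

definition negligible_nat :: "nat set \<Rightarrow> bool" where
  "negligible_nat A \<longleftrightarrow> (\<lambda>n. rho n A) \<longlonglongrightarrow> 0"

definition uniform_fun :: "(nat \<Rightarrow> nat) \<Rightarrow> bool" where
  "uniform_fun f \<longleftrightarrow> (\<forall>S. negligible_nat S \<longrightarrow> negligible_nat (f -` S))"

definition reduces_to :: "(nat \<Rightarrow> nat) \<Rightarrow> nat set \<Rightarrow> nat set \<Rightarrow> bool" where
  "reduces_to f A B \<longleftrightarrow> f ` A \<subseteq> B \<and> f ` (UNIV - A) \<subseteq> UNIV - B"

end

theory Submission
  imports Defs
begin

text \<open>
  It suffices to find, for every non-negligible \<open>B\<close>, a uniform function with values in \<open>B\<close>: one such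
  function for \<open>B\<close> used on \<open>A\<close> and one for the complement of \<open>B\<close> used off \<open>A\<close> combine to the
  reduction. Fix \<open>\<delta> > 0\<close> such that the set \<open>G\<close> of all \<open>m\<close> with \<open>card (B \<inter> {..<m}) \<ge> \<delta> m\<close> is
  infinite. Cut the natural numbers into consecutive intervals and map each of them injectively
  onto \<open>B \<inter> {..<m}\<close>, where \<open>m\<close> is the largest element of \<open>G\<close> not exceeding the left endpoint of the
  interval. If \<open>S\<close> is negligible, it meets at most an \<open>\<epsilon>\<close>-fraction of
  \<open>B \<inter> {..<m}\<close> for large \<open>m\<close>, so its preimage has density at most \<open>\<epsilon>\<close> at the interval endpoints, up
  to a bounded error; as consecutive endpoints differ at most by the factor 2, it has density at
  most \<open>2 \<epsilon>\<close> in between.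
\<close>

text \<open>An additive form of density zero whose bounds can be summed. The constant
  \<open>K\<close> absorbs the initial \<open>n\<close> at which the ratio is still large;
  conversely, half of the slope allowed by \<open>r\<close> is kept to dominate \<open>K\<close> for
  large \<open>n\<close>.\<close>

lemma negligible_nat_iff:
  "negligible_nat S \<longleftrightarrow>
    (\<forall>e>0. \<exists>K. \<forall>n. real (card (S \<inter> {..<n})) \<le> K + e * real n)"
proof -
  have rho: "rho n S = real (card (S \<inter> {..<n})) / real n" for n
    unfolding rho_def by (rule arg_cong[where f="\<lambda>X. real (card X) / real n"]) auto
  show ?thesis
  proof (intro iffI allI impI)
    fix e :: real
    assume "negligible_nat S" and e: "e > 0"
    then obtain N where N: "\<And>n. n \<ge> N \<Longrightarrow> \<bar>rho n S\<bar> < e"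
      unfolding negligible_nat_def LIMSEQ_iff by fastforce
    have "real (card (S \<inter> {..<n})) \<le> real N + e * real n" for n
    proof (cases "n \<ge> N \<and> n > 0")
      case True
      then have "real (card (S \<inter> {..<n})) / real n < e" using N[of n] rho[of n] by auto
      then have "real (card (S \<inter> {..<n})) < e * real n" using True by (simp add: field_simps)
      then show ?thesis by simp
    next
      case False
      have "card (S \<inter> {..<n}) \<le> n" using card_mono[of "{..<n}" "S \<inter> {..<n}"] by simp
      then have "real (card (S \<inter> {..<n})) \<le> real N" using False by auto
      moreover have "0 \<le> e * real n" using e by simp
      ultimately show ?thesis by linarith
    qed
    then show "\<exists>K. \<forall>n. real (card (S \<inter> {..<n})) \<le> K + e * real n" by blast
  next
    assume R: "\<forall>e>0. \<exists>K. \<forall>n. real (card (S \<inter> {..<n})) \<le> K + e * real n"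
    show "negligible_nat S"
      unfolding negligible_nat_def LIMSEQ_iff
    proof (intro allI impI)
      fix r :: real assume r: "r > 0"
      then obtain K where K: "\<And>n. real (card (S \<inter> {..<n})) \<le> K + r / 2 * real n"
        using R half_gt_zero by meson
      obtain N :: nat where N: "real N > 2 * K / r" using reals_Archimedean2 by blast
      have "norm (rho n S - 0) < r" if n: "n \<ge> Suc N" for n
      proof -
        have "real n > 2 * K / r" using N n by linarith
        then have "K < r / 2 * real n" using r by (simp add: field_simps)
        then have "real (card (S \<inter> {..<n})) < r * real n" using K[of n] by simp
        then have "rho n S < r" using n by (simp add: rho field_simps)
        moreover have "rho n S \<ge> 0" by (simp add: rho)
        ultimately show ?thesis by simp
      qed
      then show "\<exists>N. \<forall>n\<ge>N. norm (rho n S - 0) < r" by blast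
    qed
  qed
qed

lemma negligible_nat_subset_Un:
  assumes "negligible_nat S" "negligible_nat T" "U \<subseteq> S \<union> T"
  shows "negligible_nat U"
  unfolding negligible_nat_iff
proof (intro allI impI)
  fix e :: real assume "e > 0"
  then have "e / 2 > 0" by simp
  then obtain K L where
    K: "\<And>n. real (card (S \<inter> {..<n})) \<le> K + e / 2 * real n" and
    L: "\<And>n. real (card (T \<inter> {..<n})) \<le> L + e / 2 * real n"
    using assms(1,2) unfolding negligible_nat_iff by meson
  have "real (card (U \<inter> {..<n})) \<le> (K + L) + e * real n" for n
  proof -
    have "card (U \<inter> {..<n}) \<le> card ((S \<inter> {..<n}) \<union> (T \<inter> {..<n}))"
      by (rule card_mono) (use assms(3) in auto)
    also have "\<dots> \<le> card (S \<inter> {..<n}) + card (T \<inter> {..<n})" by (rule card_Un_le)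
    finally show ?thesis using K[of n] L[of n] by (simp add: field_simps)
  qed
  then show "\<exists>K. \<forall>n. real (card (U \<inter> {..<n})) \<le> K + e * real n" by blast
qed

text \<open>A preimage under the combined function lies in the union of the two preimages, whatever
  \<open>P\<close> is. This is what lets \<open>A\<close> be arbitrary in the reduction.\<close>

lemma uniform_fun_if:
  assumes "uniform_fun g" "uniform_fun h"
  shows "uniform_fun (\<lambda>k. if P k then g k else h k)"
  unfolding uniform_fun_def
proof (intro allI impI)
  fix S assume "negligible_nat S"
  then have "negligible_nat (g -` S)" "negligible_nat (h -` S)"
    using assms unfolding uniform_fun_def by auto
  then show "negligible_nat ((\<lambda>k. if P k then g k else h k) -` S)"
    by (rule negligible_nat_subset_Un) (auto split: if_splits)
qed

text \<open>Some slope \<open>d\<close> fails for every additive constant. Taking the constant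
  \<open>N\<close>, the count exceeds \<open>N\<close> but is at most \<open>n\<close>, so the
  witness \<open>n\<close> lies beyond \<open>N\<close>.\<close>

lemma not_negligible_imp_unbounded_dense:
  assumes "\<not> negligible_nat B"
  obtains d :: real where "d > 0" "\<And>N. \<exists>m>N. d * real m \<le> real (card (B \<inter> {..<m}))"
proof -
  obtain d :: real where d: "d > 0"
    and D: "\<And>K. \<exists>n. real (card (B \<inter> {..<n})) > K + d * real n"
    using assms unfolding negligible_nat_iff by (meson not_le)
  have "\<exists>m>N. d * real m \<le> real (card (B \<inter> {..<m}))" for N
  proof -
    obtain n where n: "real (card (B \<inter> {..<n})) > real N + d * real n" using D by blast
    have "card (B \<inter> {..<n}) \<le> n" using card_mono[of "{..<n}" "B \<inter> {..<n}"] by simp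
    moreover have "0 \<le> d * real n" using d by simp
    ultimately have "n > N" using n by linarith
    then show ?thesis using n by auto
  qed
  then show thesis using that[OF d] by blast
qed

lemma ex_fun_inj_on_intervals:
  fixes T :: "nat \<Rightarrow> nat"
  assumes T: "strict_mono T" and B: "B \<noteq> {}"
    and C: "\<And>j. C j \<subseteq> B" "\<And>j. finite (C j)" "\<And>j. T (Suc j) \<le> T j + card (C j)"
  obtains g :: "nat \<Rightarrow> nat" where "range g \<subseteq> B"
    "\<And>j. inj_on g {T j..<T (Suc j)}" "\<And>j. g ` {T j..<T (Suc j)} \<subseteq> C j"
proof -
  obtain b where b: "b \<in> B" using B by blast
  have "\<exists>h. h ` {T j..<T (Suc j)} \<subseteq> C j \<and> inj_on h {T j..<T (Suc j)}" for j
    by (rule card_le_inj) (use C(2)[of j] C(3)[of j] in auto)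
  then obtain h where h: "\<And>j. h j ` {T j..<T (Suc j)} \<subseteq> C j"
    "\<And>j. inj_on (h j) {T j..<T (Suc j)}" by metis
  define stage where "stage k = (LEAST j. k < T (Suc j))" for k
  have stage: "stage k = j" if "k \<in> {T j..<T (Suc j)}" for j k
    unfolding stage_def
  proof (rule Least_equality)
    show "k < T (Suc j)" using that by simp
    fix i assume "k < T (Suc i)"
    then have "T j < T (Suc i)" using that by simp
    then have "j < Suc i" using T by (simp add: strict_mono_less)
    then show "j \<le> i" by simp
  qed
  \<comment> \<open>\<open>stage k\<close> is the index of the interval containing \<open>k\<close>.
    The finitely many points before \<open>T 0\<close> lie in no interval and get the default value
    \<open>b\<close>.\<close>
  define g where "g k = (if k < T 0 then b else h (stage k) k)" for k
  have g: "g k = h j k" if "k \<in> {T j..<T (Suc j)}" for j k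
  proof -
    have "T 0 \<le> T j" using T by (simp add: strict_mono_less_eq)
    then show ?thesis using that stage[OF that] by (simp add: g_def)
  qed
  show thesis
  proof
    show "inj_on g {T j..<T (Suc j)}" for j
      by (rule inj_onI) (simp add: g[of _ j] inj_on_eq_iff[OF h(2)[of j]])
    show gC: "g ` {T j..<T (Suc j)} \<subseteq> C j" for j
      using h(1)[of j] g[of _ j] by auto
    show "range g \<subseteq> B"
    proof (rule image_subsetI)
      fix k :: nat
      show "g k \<in> B"
      proof (cases "k < T 0")
        case False
        have "k < T (Suc k)" using strict_mono_imp_increasing[OF T, of "Suc k"] by simp
        then have "k < T (Suc (stage k))" unfolding stage_def by (rule LeastI)
        moreover have "T (stage k) \<le> k"
        proof (cases "stage k")
          case (Suc i)
          then have "\<not> k < T (Suc i)"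
            unfolding stage_def by (metis lessI not_less_Least)
          then show ?thesis using Suc by simp
        qed (use False in simp)
        ultimately have "k \<in> {T (stage k)..<T (Suc (stage k))}" by simp
        then show ?thesis using gC[of "stage k"] C(1)[of "stage k"] by blast
      qed (simp add: g_def b)
    qed
  qed
qed

lemma ex_uniform_fun_into:
  assumes "\<not> negligible_nat B"
  obtains g where "uniform_fun g" "range g \<subseteq> B"
proof -
  obtain d :: real where d: "d > 0"
    and dense: "\<And>N. \<exists>m>N. d * real m \<le> real (card (B \<inter> {..<m}))"
    using not_negligible_imp_unbounded_dense[OF assms] by metis
  define G where "G = {m. d * real m \<le> real (card (B \<inter> {..<m}))}"
  have G: "\<exists>m>N. m \<in> G" for N
    using dense by (simp add: G_def)
  \<comment> \<open>Starting at a positive element of \<open>G\<close> makes the maximum in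
    \<open>M t\<close> exist for \<open>t \<ge> m0\<close> and forces
    \<open>M t \<ge> m0 > 0\<close>, so every interval below is nonempty.\<close>
  obtain m0 where m0: "m0 > 0" "m0 \<in> G" using G by blast
  define M where "M t = Max {m \<in> G. m \<le> t}" for t
  define c where "c m = card (B \<inter> {..<m})" for m
  have M: "M t \<in> G" "M t \<le> t" if "t \<ge> m0" for t
  proof -
    have "M t \<in> {m \<in> G. m \<le> t}"
      unfolding M_def by (rule Max_in) (use m0(2) that in auto)
    then show "M t \<in> G" "M t \<le> t" by auto
  qed
  have M_ge: "m \<le> M t" if "m \<in> G" "m \<le> t" for m t
    unfolding M_def using that by (intro Max_ge) auto
  have c_le: "c m \<le> m" for m
    unfolding c_def using card_mono[of "{..<m}" "B \<inter> {..<m}"] by simp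
  have c_ge: "d * real m \<le> real (c m)" if "m \<in> G" for m using that by (simp add: G_def c_def)
  \<comment> \<open>Each interval is exactly as long as its target
    \<open>B \<inter> {..<M t}\<close> is large, so errors proportional to the target sizes add up
    to an error proportional to the endpoint.\<close>
  define T where "T = rec_nat m0 (\<lambda>_ t. t + c (M t))"
  have T0: "T 0 = m0" and TSuc: "T (Suc j) = T j + c (M (T j))" for j
    by (simp_all add: T_def)
  have T_ge: "T j \<ge> m0" for j by (induction j) (auto simp: T0 TSuc)
  have c_pos: "c (M (T j)) > 0" for j
  proof -
    have "0 < d * real (M (T j))" using d m0 M_ge[OF m0(2) T_ge[of j]] by simp
    also have "\<dots> \<le> real (c (M (T j)))" by (rule c_ge) (rule M(1)[OF T_ge])
    finally show ?thesis by simp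
  qed
  have T: "strict_mono T" by (rule strict_mono_Suc_iff[THEN iffD2]) (simp add: TSuc c_pos)
  have T_double: "T (Suc j) \<le> 2 * T j" for j
    using c_le[of "M (T j)"] M(2)[OF T_ge[of j]] by (simp add: TSuc)
  have "B \<noteq> {}" using c_pos[of 0] by (auto simp: c_def)
  then obtain g where g: "range g \<subseteq> B" "\<And>j. inj_on g {T j..<T (Suc j)}"
    "\<And>j. g ` {T j..<T (Suc j)} \<subseteq> B \<inter> {..<M (T j)}"
    by (rule ex_fun_inj_on_intervals[OF T, of B "\<lambda>j. B \<inter> {..<M (T j)}"]) (simp_all add: TSuc c_def)
  have "negligible_nat (g -` S)" if S: "negligible_nat S" for S
    unfolding negligible_nat_iff
  proof (intro allI impI)
    fix e :: real assume e: "e > 0"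
    define cnt where "cnt n = real (card (g -` S \<inter> {..<n}))" for n
    have cnt_mono: "cnt n \<le> cnt n'" if "n \<le> n'" for n n'
      unfolding cnt_def using that by (auto intro!: card_mono)
    \<comment> \<open>With \<open>m = M (T j)\<close>, one share \<open>e * d / 4 * m\<close> bounds
      the growth of \<open>S\<close> and a second absorbs \<open>K\<close>. Together they give
      \<open>e / 2 * (d * m)\<close>, at most \<open>e / 2 * c m\<close>.\<close>
    have "e * d / 4 > 0" using e d by simp
    then obtain K where K: "\<And>n. real (card (S \<inter> {..<n})) \<le> K + e * d / 4 * real n"
      using S unfolding negligible_nat_iff by meson
    obtain N :: nat where N: "real N > 4 * K / (e * d)" using reals_Archimedean2 by blast
    \<comment> \<open>Membership of \<open>J\<close> in \<open>G\<close> ensures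
      \<open>M (T j) \<ge> J > N\<close> as soon as \<open>T j \<ge> J\<close>.\<close>
    obtain J where J: "J > N" "J \<in> G" using G by blast
    have step: "cnt (T (Suc j)) \<le> cnt (T j) + e / 2 * real (c (M (T j)))" if j: "T j \<ge> J" for j
    proof -
      let ?I = "{T j..<T (Suc j)}" and ?m = "M (T j)"
      have "g -` S \<inter> {..<T (Suc j)} \<subseteq> (g -` S \<inter> {..<T j}) \<union> (g -` S \<inter> ?I)" by auto
      then have "card (g -` S \<inter> {..<T (Suc j)}) \<le> card ((g -` S \<inter> {..<T j}) \<union> (g -` S \<inter> ?I))"
        by (intro card_mono) auto
      also have "\<dots> \<le> card (g -` S \<inter> {..<T j}) + card (g -` S \<inter> ?I)" by (rule card_Un_le)
      finally have 1: "cnt (T (Suc j)) \<le> cnt (T j) + real (card (g -` S \<inter> ?I))"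
        by (simp add: cnt_def)
      have "card (g -` S \<inter> ?I) \<le> card (S \<inter> {..<?m})"
        by (rule card_inj_on_le[of g]) (use g(3)[of j] in \<open>auto intro: inj_on_subset[OF g(2)[of j]]\<close>)
      then have 2: "real (card (g -` S \<inter> ?I)) \<le> K + e * d / 4 * real ?m"
        using K[of ?m] by linarith
      have "real ?m > 4 * K / (e * d)" using N J M_ge[OF J(2) j] by linarith
      then have "K < e * d / 4 * real ?m" using e d by (simp add: field_simps)
      then have "real (card (g -` S \<inter> ?I)) \<le> e / 2 * (d * real ?m)" using 2 by simp
      also have "\<dots> \<le> e / 2 * real (c ?m)"
        using c_ge[OF M(1)[OF T_ge[of j]]] e by (intro mult_left_mono) auto
      finally show ?thesis using 1 by linarith
    qed
    \<comment> \<open>Here \<open>J\<close> also serves as an index: since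
      \<open>j \<le> T j\<close>, the estimate \<open>step\<close> applies from \<open>j = J\<close>
      on, and monotonicity covers the earlier endpoints.\<close>
    have ends: "cnt (T j) \<le> cnt (T J) + e / 2 * real (T j)" for j
    proof (induction j)
      case 0
      have "cnt (T 0) \<le> cnt (T J)"
        using T by (intro cnt_mono) (simp add: strict_mono_less_eq)
      moreover have "0 \<le> e / 2 * real (T 0)" using e by simp
      ultimately show ?case by linarith
    next
      case (Suc j)
      show ?case
      proof (cases "j < J")
        case True
        then have "cnt (T (Suc j)) \<le> cnt (T J)"
          using T by (intro cnt_mono) (simp add: strict_mono_less_eq)
        moreover have "0 \<le> e / 2 * real (T (Suc j))" using e by simp
        ultimately show ?thesis by linarith
      next
        case False
        then have "T j \<ge> J" using strict_mono_imp_increasing[OF T, of j] by linarith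
        from step[OF this] Suc show ?thesis by (simp add: TSuc algebra_simps)
      qed
    qed
    \<comment> \<open>The term \<open>cnt (T 0)\<close> covers \<open>n\<close> before the first
      interval. Otherwise \<open>n\<close> is compared with the next endpoint, and the doubling
      bound turns \<open>e / 2\<close> into \<open>e\<close>.\<close>
    have "cnt n \<le> (cnt (T J) + cnt (T 0)) + e * real n" for n
    proof (cases "n < T 0")
      case True
      then have "cnt n \<le> cnt (T 0)" by (intro cnt_mono) simp
      moreover have "0 \<le> e * real n" "cnt (T J) \<ge> 0" using e by (simp_all add: cnt_def)
      ultimately show ?thesis by linarith
    next
      case False
      have "n < T (Suc n)" using strict_mono_imp_increasing[OF T, of "Suc n"] by simp
      then obtain j where j: "T j \<le> n" "n < T (Suc j)"
        using ex_least_nat_less[of "\<lambda>i. n < T i" "Suc n"] False by (meson not_less order_refl)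
      have "cnt n \<le> cnt (T (Suc j))" using j by (intro cnt_mono) simp
      also have "\<dots> \<le> cnt (T J) + e / 2 * real (T (Suc j))" by (rule ends)
      also have "\<dots> \<le> cnt (T J) + e / 2 * (2 * real n)"
        using T_double[of j] j e by (intro add_left_mono mult_left_mono) auto
      finally show ?thesis by (simp add: cnt_def)
    qed
    then show "\<exists>K. \<forall>n. real (card (g -` S \<inter> {..<n})) \<le> K + e * real n"
      unfolding cnt_def by blast
  qed
  then have "uniform_fun g" by (simp add: uniform_fun_def)
  then show thesis using that g(1) by blast
qed

theorem theorem2:
  fixes A B :: "nat set"
  assumes "\<not> negligible_nat B"
    and "\<not> negligible_nat (UNIV - B)"
  shows "\<exists>f :: nat \<Rightarrow> nat. uniform_fun f \<and> reduces_to f A B"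
proof -
  obtain g where g: "uniform_fun g" "range g \<subseteq> B" by (rule ex_uniform_fun_into[OF assms(1)])
  obtain h where h: "uniform_fun h" "range h \<subseteq> UNIV - B"
    by (rule ex_uniform_fun_into[OF assms(2)])
  have "reduces_to (\<lambda>k. if k \<in> A then g k else h k) A B"
    using g(2) h(2) unfolding reduces_to_def by auto
  with uniform_fun_if[OF g(1) h(1)] show ?thesis by (intro exI conjI)
qed

end
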